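(* Let $S\in\mathfrak S$ and let $U,V$ be (+)-admissible sequences on $(\Gamma,\Lambda^S)$. (a) $SU\preccurlyeq SV$ if and only if $U\preccurlyeq V$. (b) $SU\sim SV$ if and only if $U\sim V$.
   Context: $\Gamma=(\Gamma_0,\Gamma_1)$ is a finite connected graph (multiple edges allowed) without loops and with more than one vertex. An orientation $\Lambda$ on $\Gamma$ chooses for each edge a starting point and an endpoint among its incident vertices, giving a quiver $(\Gamma,\Lambda)$; all orientations are assumed to have no oriented cycles. A sink is a vertex at which no arrow starts. $\sigma_x\Lambda$ is the orientation obtained by reversing all arrows incident with $x$. A finite sequence $S=x_1,\dots,x_s$ of vertices ($s\ge 0$) is (+)-admissible on $(\Gamma,\Lambda)$ if $x_1$ is a sink for $\Lambda$, $x_2$ is a sink for $\sigma_{x_1}\Lambda$, and so on; put $\Lambda^S=\sigma_{x_s}\cdots\sigma_{x_1}\Lambda$. $\mathfrak S$ is the set of (+)-admissible sequences on $(\Gamma,\Lambda)$. Juxtaposition $SU$ denotes concatenation. On the set of (+)-admissible sequences on any given quiver $(\Gamma,\Theta)$, $\sim$ is the equivalence relation generated by interchanging two consecutive terms $x_i,x_{i+1}$ that are not connected by an edge of $\Gamma$, and $S\preccurlyeq T$ means $T\sim SU$ for some (+)-admissible sequence $U$ on $(\Gamma,\Theta^S)$. In the claim, relations between $SU$ and $SV$ are taken on $(\Gamma,\Lambda)$ and relations between $U$ and $V$ on $(\Gamma,\Lambda^S)$. *)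

theory Defs
  imports "Graph_Theory.Arc_Walk"
begin

record ('v, 'e) multigraph =
  vertices :: "'v set"
  edges :: "'e set"
  ends :: "'e \<Rightarrow> 'v set"

definition adjacent :: "('v, 'e) multigraph \<Rightarrow> 'v \<Rightarrow> 'v \<Rightarrow> bool" where
  "adjacent \<Gamma> x y \<longleftrightarrow> (\<exists>e \<in> edges \<Gamma>. ends \<Gamma> e = {x, y})"

text \<open>Requiring two distinct endpoints of each edge excludes loops; parallel edges are
  distinct elements of \<^term>\<open>edges \<Gamma>\<close> with the same endpoints.\<close>

locale connected_multigraph =
  fixes \<Gamma> :: "('v, 'e) multigraph"
  assumes finite_vertices: "finite (vertices \<Gamma>)"
    and finite_edges: "finite (edges \<Gamma>)"
    and ends_in_vertices: "\<And>e. e \<in> edges \<Gamma> \<Longrightarrow> ends \<Gamma> e \<subseteq> vertices \<Gamma>"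
    and card_ends: "\<And>e. e \<in> edges \<Gamma> \<Longrightarrow> card (ends \<Gamma> e) = 2"
    and connected: "\<And>x y. x \<in> vertices \<Gamma> \<Longrightarrow> y \<in> vertices \<Gamma> \<Longrightarrow> (adjacent \<Gamma>)\<^sup>*\<^sup>* x y"
    and more_than_one_vertex: "card (vertices \<Gamma>) > 1"

text \<open>An orientation sends an edge to the pair (starting point, endpoint). Its values outside
  \<^term>\<open>edges \<Gamma>\<close> are irrelevant.\<close>

type_synonym ('v, 'e) orientation = "'e \<Rightarrow> 'v \<times> 'v"

definition quiver :: "('v, 'e) multigraph \<Rightarrow> ('v, 'e) orientation \<Rightarrow> ('v, 'e) pre_digraph" where
  "quiver \<Gamma> \<Lambda> =
     \<lparr>verts = vertices \<Gamma>, arcs = edges \<Gamma>, tail = (\<lambda>e. fst (\<Lambda> e)), head = (\<lambda>e. snd (\<Lambda> e))\<rparr>"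

definition is_orientation :: "('v, 'e) multigraph \<Rightarrow> ('v, 'e) orientation \<Rightarrow> bool" where
  "is_orientation \<Gamma> \<Lambda> \<longleftrightarrow> (\<forall>e \<in> edges \<Gamma>. {fst (\<Lambda> e), snd (\<Lambda> e)} = ends \<Gamma> e)"

definition acyclic_orientation :: "('v, 'e) multigraph \<Rightarrow> ('v, 'e) orientation \<Rightarrow> bool" where
  "acyclic_orientation \<Gamma> \<Lambda> \<longleftrightarrow>
     is_orientation \<Gamma> \<Lambda> \<and> \<not> (\<exists>p. pre_digraph.cycle (quiver \<Gamma> \<Lambda>) p)"

definition sink :: "('v, 'e) multigraph \<Rightarrow> ('v, 'e) orientation \<Rightarrow> 'v \<Rightarrow> bool" where
  "sink \<Gamma> \<Lambda> x \<longleftrightarrow> x \<in> vertices \<Gamma> \<and> out_arcs (quiver \<Gamma> \<Lambda>) x = {}"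

definition reflect ::
  "('v, 'e) multigraph \<Rightarrow> 'v \<Rightarrow> ('v, 'e) orientation \<Rightarrow> ('v, 'e) orientation" where
  "reflect \<Gamma> x \<Lambda> = (\<lambda>e. if x \<in> ends \<Gamma> e then prod.swap (\<Lambda> e) else \<Lambda> e)"

text \<open>\<open>\<Lambda>\<^sup>S = \<sigma>\<^bsub>x\<^sub>s\<^esub> \<dots> \<sigma>\<^bsub>x\<^sub>1\<^esub> \<Lambda>\<close> for \<open>S = [x\<^sub>1, \<dots>, x\<^sub>s]\<close>; \<open>fold\<close> applies
  \<open>\<sigma>\<^bsub>x\<^sub>1\<^esub>\<close> first.\<close>

definition reflect_seq ::
  "('v, 'e) multigraph \<Rightarrow> ('v, 'e) orientation \<Rightarrow> 'v list \<Rightarrow> ('v, 'e) orientation" where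
  "reflect_seq \<Gamma> \<Lambda> S = fold (reflect \<Gamma>) S \<Lambda>"

fun admissible :: "('v, 'e) multigraph \<Rightarrow> ('v, 'e) orientation \<Rightarrow> 'v list \<Rightarrow> bool" where
  "admissible \<Gamma> \<Lambda> [] \<longleftrightarrow> True"
| "admissible \<Gamma> \<Lambda> (x # S) \<longleftrightarrow> sink \<Gamma> \<Lambda> x \<and> admissible \<Gamma> (reflect \<Gamma> x \<Lambda>) S"

definition interchange ::
  "('v, 'e) multigraph \<Rightarrow> ('v, 'e) orientation \<Rightarrow> 'v list \<Rightarrow> 'v list \<Rightarrow> bool" where
  "interchange \<Gamma> \<Theta> S T \<longleftrightarrow>
     admissible \<Gamma> \<Theta> S \<and> admissible \<Gamma> \<Theta> T \<and>
     (\<exists>A x y B. S = A @ [x, y] @ B \<and> T = A @ [y, x] @ B \<and> \<not> adjacent \<Gamma> x y)"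

text \<open>Since \<^const>\<open>equivclp\<close> is reflexive on all lists,
  membership in the set of admissible sequences is required separately.\<close>

definition seq_equiv ::
  "('v, 'e) multigraph \<Rightarrow> ('v, 'e) orientation \<Rightarrow> 'v list \<Rightarrow> 'v list \<Rightarrow> bool" where
  "seq_equiv \<Gamma> \<Theta> S T \<longleftrightarrow>
     admissible \<Gamma> \<Theta> S \<and> admissible \<Gamma> \<Theta> T \<and> equivclp (interchange \<Gamma> \<Theta>) S T"

definition seq_prec ::
  "('v, 'e) multigraph \<Rightarrow> ('v, 'e) orientation \<Rightarrow> 'v list \<Rightarrow> 'v list \<Rightarrow> bool" where
  "seq_prec \<Gamma> \<Theta> S T \<longleftrightarrow>
     admissible \<Gamma> \<Theta> S \<and> admissible \<Gamma> \<Theta> T \<and>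
     (\<exists>U. admissible \<Gamma> (reflect_seq \<Gamma> \<Theta> S) U \<and> seq_equiv \<Gamma> \<Theta> T (S @ U))"

end

theory Submission
  imports Defs
begin

text \<open>Part (b) is left cancellation for sequences modulo interchange, and it suffices to cancel a
  single sink \<open>x\<close>. The inverse of prefixing \<open>x\<close> is deletion of the first \<open>x\<close>, which unlike
  cancellation is defined on every sequence, so it can be applied along a whole chain of
  interchanges from \<open>xU\<close> to \<open>xV\<close>. It turns an interchange either into an interchange or into an
  equality, the latter when the deleted \<open>x\<close> is one of the two interchanged terms.

  What has to be seen is that deletion respects admissibility: if \<open>x\<close> is a sink of \<open>\<Lambda>\<close> and \<open>W\<close> is
  admissible on \<open>(\<Gamma>, \<Lambda>)\<close>, then \<open>W\<close> without its first \<open>x\<close> is admissible on \<open>(\<Gamma>, \<sigma>\<^sub>x\<Lambda>)\<close>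
  (\<open>admissible_remove1\<close>). The reason is that distinct sinks are never adjacent, so no neighbour of
  \<open>x\<close> occurs in \<open>W\<close> before \<open>x\<close> does, and the reflection at \<open>x\<close> may as well be carried out first.

  Part (a) follows from (b): \<open>SV \<sim> SUW\<close> and \<open>V \<sim> UW\<close> are equivalent for every \<open>W\<close>.\<close>

lemma is_orientation_reflect:
  "is_orientation \<Gamma> \<Lambda> \<Longrightarrow> is_orientation \<Gamma> (reflect \<Gamma> x \<Lambda>)"
  by (auto simp: is_orientation_def reflect_def)

lemma reflect_commute: "reflect \<Gamma> x (reflect \<Gamma> y \<Lambda>) = reflect \<Gamma> y (reflect \<Gamma> x \<Lambda>)"
  by (auto simp: reflect_def)

lemma reflect_seq_Cons: "reflect_seq \<Gamma> \<Lambda> (x # S) = reflect_seq \<Gamma> (reflect \<Gamma> x \<Lambda>) S"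
  by (simp add: reflect_seq_def)

lemma reflect_seq_append: "reflect_seq \<Gamma> \<Lambda> (S @ T) = reflect_seq \<Gamma> (reflect_seq \<Gamma> \<Lambda> S) T"
  by (simp add: reflect_seq_def)

lemma admissible_append:
  "admissible \<Gamma> \<Lambda> (S @ T) \<longleftrightarrow> admissible \<Gamma> \<Lambda> S \<and> admissible \<Gamma> (reflect_seq \<Gamma> \<Lambda> S) T"
  by (induction S arbitrary: \<Lambda>) (simp_all add: reflect_seq_def)

text \<open>An edge incident with both \<open>x\<close> and \<open>y\<close> would start at one of the two, so every edge at \<open>x\<close>
  joins it to a vertex other than \<open>y\<close> and its reversal is not seen by \<open>y\<close>.\<close>

lemma sink_reflect:
  assumes "is_orientation \<Gamma> \<Lambda>" "sink \<Gamma> \<Lambda> x" "sink \<Gamma> \<Lambda> y" "x \<noteq> y"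
  shows "sink \<Gamma> (reflect \<Gamma> x \<Lambda>) y"
proof -
  have "fst (reflect \<Gamma> x \<Lambda> e) \<noteq> y" if e: "e \<in> edges \<Gamma>" for e
  proof -
    have "ends \<Gamma> e = {fst (\<Lambda> e), snd (\<Lambda> e)}" "fst (\<Lambda> e) \<noteq> x" "fst (\<Lambda> e) \<noteq> y"
      using assms e by (auto simp: is_orientation_def sink_def quiver_def out_arcs_def)
    then show ?thesis
      using \<open>x \<noteq> y\<close> by (auto simp: reflect_def)
  qed
  then show ?thesis
    using assms by (auto simp: sink_def quiver_def out_arcs_def)
qed

text \<open>As long as \<open>x\<close> has not occurred it stays a sink, and it is one of the sinks alongside each
  term that is applied instead, so reflecting at \<open>x\<close> in advance disturbs none of these terms.\<close>

lemma admissible_remove1: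
  assumes "is_orientation \<Gamma> \<Lambda>" "sink \<Gamma> \<Lambda> x" "admissible \<Gamma> \<Lambda> W"
  shows "admissible \<Gamma> (reflect \<Gamma> x \<Lambda>) (remove1 x W)"
  using assms
proof (induction W arbitrary: \<Lambda>)
  case Nil
  then show ?case by simp
next
  case (Cons y W)
  show ?case
  proof (cases "x = y")
    case True
    then show ?thesis using Cons.prems by simp
  next
    case False
    have y: "sink \<Gamma> \<Lambda> y" "admissible \<Gamma> (reflect \<Gamma> y \<Lambda>) W"
      using Cons.prems by auto
    have "sink \<Gamma> (reflect \<Gamma> y \<Lambda>) x"
      by (rule sink_reflect[OF Cons.prems(1) y(1) Cons.prems(2) False[symmetric]])
    then have "admissible \<Gamma> (reflect \<Gamma> x (reflect \<Gamma> y \<Lambda>)) (remove1 x W)"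
      by (rule Cons.IH[OF is_orientation_reflect[OF Cons.prems(1)] _ y(2)])
    moreover have "sink \<Gamma> (reflect \<Gamma> x \<Lambda>) y"
      by (rule sink_reflect[OF Cons.prems(1,2) y(1) False])
    ultimately show ?thesis
      using False by (simp add: reflect_commute[of \<Gamma> x y])
  qed
qed

lemma interchangeI:
  assumes "admissible \<Gamma> \<Lambda> S" "admissible \<Gamma> \<Lambda> T"
    and "S = A @ [a, b] @ B" "T = A @ [b, a] @ B" "\<not> adjacent \<Gamma> a b"
  shows "interchange \<Gamma> \<Lambda> S T"
  unfolding interchange_def
proof (intro conjI assms(1,2))
  have "S = A @ [a, b] @ B \<and> T = A @ [b, a] @ B \<and> \<not> adjacent \<Gamma> a b"
    by (intro conjI assms(3-5))
  then show "\<exists>A a b B. S = A @ [a, b] @ B \<and> T = A @ [b, a] @ B \<and> \<not> adjacent \<Gamma> a b"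
    by (intro exI)
qed

lemma interchangeE:
  assumes "interchange \<Gamma> \<Lambda> S T"
  obtains A a b B where "admissible \<Gamma> \<Lambda> S" "admissible \<Gamma> \<Lambda> T"
    "S = A @ [a, b] @ B" "T = A @ [b, a] @ B" "\<not> adjacent \<Gamma> a b"
  using assms unfolding interchange_def by (elim conjE exE) (rule that)

text \<open>The two sequences become equal when the first \<open>x\<close> is itself one of the interchanged terms;
  otherwise the interchanged pair survives the deletion.\<close>

lemma interchange_remove1:
  assumes "is_orientation \<Gamma> \<Lambda>" "sink \<Gamma> \<Lambda> x" "interchange \<Gamma> \<Lambda> S T"
  shows "remove1 x S = remove1 x T \<or> interchange \<Gamma> (reflect \<Gamma> x \<Lambda>) (remove1 x S) (remove1 x T)"
proof -
  from assms(3) obtain A a b B where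
    ST: "admissible \<Gamma> \<Lambda> S" "admissible \<Gamma> \<Lambda> T"
      "S = A @ [a, b] @ B" "T = A @ [b, a] @ B" "\<not> adjacent \<Gamma> a b"
    by (rule interchangeE)
  have adm: "admissible \<Gamma> (reflect \<Gamma> x \<Lambda>) (remove1 x S)"
    "admissible \<Gamma> (reflect \<Gamma> x \<Lambda>) (remove1 x T)"
    by (rule admissible_remove1[OF assms(1,2) ST(1)], rule admissible_remove1[OF assms(1,2) ST(2)])
  consider "x \<in> set A" | "x \<notin> set A" "x = a \<or> x = b" | "x \<notin> set A" "x \<noteq> a" "x \<noteq> b"
    by blast
  then show ?thesis
  proof cases
    case 1
    then have "remove1 x S = remove1 x A @ [a, b] @ B" "remove1 x T = remove1 x A @ [b, a] @ B"
      by (simp_all add: ST(3,4) remove1_append)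
    from interchangeI[OF adm this ST(5)] show ?thesis ..
  next
    case 2
    then have "remove1 x S = remove1 x T"
      by (auto simp: ST(3,4) remove1_append)
    then show ?thesis ..
  next
    case 3
    then have "remove1 x S = A @ [a, b] @ remove1 x B" "remove1 x T = A @ [b, a] @ remove1 x B"
      by (simp_all add: ST(3,4) remove1_append)
    from interchangeI[OF adm this ST(5)] show ?thesis ..
  qed
qed

lemma equivclp_map:
  assumes "equivclp r a b" "\<And>a b. r a b \<Longrightarrow> equivclp s (f a) (f b)"
  shows "equivclp s (f a) (f b)"
  using assms(1)
proof (induction rule: equivclp_induct)
  case base
  show ?case by simp
next
  case (step b c)
  then have "equivclp s (f b) (f c)"
    using assms(2) equivclp_sym by metis
  with step.IH show ?case by (rule equivclp_trans)
qed

lemma interchange_Cons: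
  assumes "sink \<Gamma> \<Lambda> x" "interchange \<Gamma> (reflect \<Gamma> x \<Lambda>) U V"
  shows "interchange \<Gamma> \<Lambda> (x # U) (x # V)"
proof -
  from assms(2) obtain A a b B where
    UV: "admissible \<Gamma> (reflect \<Gamma> x \<Lambda>) U" "admissible \<Gamma> (reflect \<Gamma> x \<Lambda>) V"
      "U = A @ [a, b] @ B" "V = A @ [b, a] @ B" "\<not> adjacent \<Gamma> a b"
    by (rule interchangeE)
  have "admissible \<Gamma> \<Lambda> (x # U)" "admissible \<Gamma> \<Lambda> (x # V)"
    using assms(1) UV(1,2) by simp_all
  moreover have "x # U = (x # A) @ [a, b] @ B" "x # V = (x # A) @ [b, a] @ B"
    by (simp_all add: UV(3,4))
  ultimately show ?thesis
    using UV(5) by (rule interchangeI)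
qed

lemma seq_equiv_Cons_iff:
  assumes "is_orientation \<Gamma> \<Lambda>" "sink \<Gamma> \<Lambda> x"
  shows "seq_equiv \<Gamma> \<Lambda> (x # U) (x # V) \<longleftrightarrow> seq_equiv \<Gamma> (reflect \<Gamma> x \<Lambda>) U V"
proof -
  have "equivclp (interchange \<Gamma> (reflect \<Gamma> x \<Lambda>)) U V"
    if "equivclp (interchange \<Gamma> \<Lambda>) (x # U) (x # V)"
  proof -
    have "equivclp (interchange \<Gamma> (reflect \<Gamma> x \<Lambda>)) (remove1 x (x # U)) (remove1 x (x # V))"
      using that
    proof (rule equivclp_map[where f = "remove1 x"])
      fix S T assume "interchange \<Gamma> \<Lambda> S T"
      from interchange_remove1[OF assms this]
      show "equivclp (interchange \<Gamma> (reflect \<Gamma> x \<Lambda>)) (remove1 x S) (remove1 x T)"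
        by (auto intro: r_into_equivclp)
    qed
    then show ?thesis by simp
  qed
  moreover have "equivclp (interchange \<Gamma> \<Lambda>) (x # U) (x # V)"
    if "equivclp (interchange \<Gamma> (reflect \<Gamma> x \<Lambda>)) U V"
    using that
    by (rule equivclp_map[where f = "(#) x"])
      (rule r_into_equivclp, rule interchange_Cons[OF assms(2)])
  ultimately show ?thesis
    using assms(2) by (auto simp: seq_equiv_def)
qed

lemma seq_equiv_append_iff:
  assumes "is_orientation \<Gamma> \<Lambda>" "admissible \<Gamma> \<Lambda> S"
  shows "seq_equiv \<Gamma> \<Lambda> (S @ U) (S @ V) \<longleftrightarrow> seq_equiv \<Gamma> (reflect_seq \<Gamma> \<Lambda> S) U V"
  using assms
proof (induction S arbitrary: \<Lambda>)
  case Nil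
  then show ?case by (simp add: reflect_seq_def)
next
  case (Cons x S)
  then show ?case
    by (simp add: seq_equiv_Cons_iff reflect_seq_Cons is_orientation_reflect)
qed

lemma seq_prec_append_iff:
  assumes "is_orientation \<Gamma> \<Lambda>" "admissible \<Gamma> \<Lambda> S"
  shows "seq_prec \<Gamma> \<Lambda> (S @ U) (S @ V) \<longleftrightarrow> seq_prec \<Gamma> (reflect_seq \<Gamma> \<Lambda> S) U V"
  using assms
  by (simp add: seq_prec_def admissible_append reflect_seq_append seq_equiv_append_iff)

theorem proposition2p5:
  fixes \<Gamma> :: "('v, 'e) multigraph"
    and \<Lambda> :: "('v, 'e) orientation"
    and S U V :: "'v list"
  assumes "connected_multigraph \<Gamma>"
    and "acyclic_orientation \<Gamma> \<Lambda>"
    and "admissible \<Gamma> \<Lambda> S"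
    and "admissible \<Gamma> (reflect_seq \<Gamma> \<Lambda> S) U"
    and "admissible \<Gamma> (reflect_seq \<Gamma> \<Lambda> S) V"
  shows "(seq_prec \<Gamma> \<Lambda> (S @ U) (S @ V) \<longleftrightarrow> seq_prec \<Gamma> (reflect_seq \<Gamma> \<Lambda> S) U V) \<and>
         (seq_equiv \<Gamma> \<Lambda> (S @ U) (S @ V) \<longleftrightarrow> seq_equiv \<Gamma> (reflect_seq \<Gamma> \<Lambda> S) U V)"
proof -
  have "is_orientation \<Gamma> \<Lambda>"
    using assms(2) by (simp add: acyclic_orientation_def)
  then show ?thesis
    using assms(3) by (simp add: seq_prec_append_iff seq_equiv_append_iff)
qed

end
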